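(* (a) Spoiler can win the $3$-round MS game on $(\{\mathsf{RT}(4)\},\{\mathsf{RT}(3)\})$ without playing on top. (b) There is no first-order sentence $\psi$ with $3$ quantifiers such that $\psi$ is a separating sentence for $(\{\mathsf{RT}(4)\},\{\mathsf{RT}(3)\})$ and both $\psi$ and $\neg\psi$ are non-replicating sentences.
   Context: Schema: one binary relation symbol $<$, no constants. $\mathsf{RT}(4)$: rooted tree with nodes $B1,B11,B12,B13,B21,B22$, root $B1$, edges $B1$–$B11$, $B11$–$B12$, $B12$–$B13$, $B1$–$B21$, $B21$–$B22$. $\mathsf{RT}(3)$: rooted tree with nodes $L1,L11,L12,L21,L22$, root $L1$, edges $L1$–$L11$, $L11$–$L12$, $L1$–$L21$, $L21$–$L22$. $x<y$ iff $x$ is a proper descendant of $y$. A separating sentence for $(\mathcal{A},\mathcal{B})$ is true on all of $\mathcal{A}$ and false on all of $\mathcal{B}$. A type over distinct variables $x_1,\dots,x_r$ is a (consistent) conjunction of atomic and negated atomic formulas containing, for each atomic formula in these variables, exactly one of it or its negation. Sentences with $r$ quantifiers are taken in the form $\psi=Q_1x_1\dots Q_rx_r\,\theta$, $\theta$ a disjunction of types; $\neg\psi$ is $\overline{Q_1}x_1\dots\overline{Q_r}x_r\,\theta'$ with dual quantifiers and $\theta'$ the disjunction of the consistent types not in $\theta$. A disjunct type $t$ of $\theta$ is non-replicating in $\psi$ if each equality $x_i=x_j$ ($i\ne j$) in $t$ has either both variables universally quantified, or one universal and one existential with the existential occurring earlier in the prefix (and each equality $c=x_j$ with $c$ a constant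 has $x_j$ universal). $\psi$ is non-replicating if all disjuncts of $\theta$ are non-replicating in $\psi$. MS game: pebbled structures carry pebble $i$ on element $a_i$; two form a matching pair if $a_i\mapsto b_i$ is an isomorphism of induced substructures. In the $r$-round MS game on $(\mathcal{A},\mathcal{B})$, in each round $t$ Spoiler picks a side and places pebble $t$ on an element of each pebbled structure there; Duplicator, for each pebbled structure on the other side, may make any number of copies and places pebble $t$ on an element of each copy; Spoiler wins once no left structure forms a matching pair with a right one; Duplicator wins if a matching pair remains after round $r$. Spoiler plays on top if he places a pebble on an element already carrying a pebble. *)

theory Defs
  imports Main
begin

section \<open>Structures with one binary relation and the two trees\<close>

record 'a bstruct =
  univ :: "'a set"
  lt :: "'a \<Rightarrow> 'a \<Rightarrow> bool"

datatype node4 = B1 | B11 | B12 | B13 | B21 | B22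

datatype node3 = L1 | L11 | L12 | L21 | L22

text \<open>Edges are oriented towards the root, as (child, parent), so that the transitive closure
  is the proper-descendant relation.\<close>

definition child4 :: "node4 rel" where
  "child4 = {(B11, B1), (B12, B11), (B13, B12), (B21, B1), (B22, B21)}"

definition child3 :: "node3 rel" where
  "child3 = {(L11, L1), (L12, L11), (L21, L1), (L22, L21)}"

definition RT4 :: "node4 bstruct" where
  "RT4 = \<lparr>univ = UNIV, lt = (\<lambda>x y. (x, y) \<in> child4\<^sup>+)\<rparr>"

definition RT3 :: "node3 bstruct" where
  "RT3 = \<lparr>univ = UNIV, lt = (\<lambda>x y. (x, y) \<in> child3\<^sup>+)\<rparr>"

section \<open>The multi-structural game\<close>

text \<open>Pebble \<open>i\<close> lies on the \<open>i\<close>-th entry of the list (counting from 0).\<close>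

type_synonym 'a pebbled = "'a bstruct \<times> 'a list"

definition matching_pair :: "'a pebbled \<Rightarrow> 'b pebbled \<Rightarrow> bool" where
  "matching_pair p q \<longleftrightarrow>
     (\<exists>f. map f (snd p) = snd q \<and> bij_betw f (set (snd p)) (set (snd q)) \<and>
          (\<forall>x\<in>set (snd p). \<forall>y\<in>set (snd p). lt (fst p) x y \<longleftrightarrow> lt (fst q) (f x) (f y)))"

definition no_match :: "'a pebbled set \<Rightarrow> 'b pebbled set \<Rightarrow> bool" where
  "no_match A B \<longleftrightarrow> (\<forall>p\<in>A. \<forall>q\<in>B. \<not> matching_pair p q)"

text \<open>With \<open>on_top = False\<close>, Spoiler may not play on top of a pebble.\<close>

definition spoiler_move :: "bool \<Rightarrow> 'a pebbled set \<Rightarrow> ('a pebbled \<Rightarrow> 'a) \<Rightarrow> bool" where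
  "spoiler_move on_top A f \<longleftrightarrow>
     (\<forall>p\<in>A. f p \<in> univ (fst p) \<and> (on_top \<or> f p \<notin> set (snd p)))"

text \<open>The set \<open>g p\<close> holds the elements pebbled in the copies that Duplicator makes of \<open>p\<close>.
  Identical pebbled structures are identified: a second copy pebbled in the same way
  contributes no new matching pair.\<close>

definition duplicator_move :: "'a pebbled set \<Rightarrow> ('a pebbled \<Rightarrow> 'a set) \<Rightarrow> bool" where
  "duplicator_move A g \<longleftrightarrow> (\<forall>p\<in>A. g p \<noteq> {} \<and> g p \<subseteq> univ (fst p))"

definition after_spoiler :: "'a pebbled set \<Rightarrow> ('a pebbled \<Rightarrow> 'a) \<Rightarrow> 'a pebbled set" where
  "after_spoiler A f = {(fst p, snd p @ [f p]) | p. p \<in> A}"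

definition after_duplicator :: "'a pebbled set \<Rightarrow> ('a pebbled \<Rightarrow> 'a set) \<Rightarrow> 'a pebbled set" where
  "after_duplicator A g = {(fst p, snd p @ [a]) | p a. p \<in> A \<and> a \<in> g p}"

text \<open>\<open>spoiler_wins on_top r A B\<close>: Spoiler has a winning strategy from position \<open>(A, B)\<close>
  with \<open>r\<close> rounds left.\<close>

fun spoiler_wins :: "bool \<Rightarrow> nat \<Rightarrow> 'a pebbled set \<Rightarrow> 'b pebbled set \<Rightarrow> bool" where
  "spoiler_wins on_top 0 A B \<longleftrightarrow> no_match A B"
| "spoiler_wins on_top (Suc r) A B \<longleftrightarrow>
     no_match A B \<or>
     (\<exists>f. spoiler_move on_top A f \<and>
        (\<forall>g. duplicator_move B g \<longrightarrow>
           spoiler_wins on_top r (after_spoiler A f) (after_duplicator B g))) \<or>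
     (\<exists>f. spoiler_move on_top B f \<and>
        (\<forall>g. duplicator_move A g \<longrightarrow>
           spoiler_wins on_top r (after_duplicator A g) (after_spoiler B f)))"

definition initial :: "'a bstruct set \<Rightarrow> 'a pebbled set" where
  "initial \<A> = {(S, []) | S. S \<in> \<A>}"

definition spoiler_can_win :: "nat \<Rightarrow> 'a bstruct set \<Rightarrow> 'b bstruct set \<Rightarrow> bool" where
  "spoiler_can_win r \<A> \<B> \<longleftrightarrow> spoiler_wins True r (initial \<A>) (initial \<B>)"

definition spoiler_can_win_without_top ::
    "nat \<Rightarrow> 'a bstruct set \<Rightarrow> 'b bstruct set \<Rightarrow> bool" where
  "spoiler_can_win_without_top r \<A> \<B> \<longleftrightarrow> spoiler_wins False r (initial \<A>) (initial \<B>)"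

section \<open>Types and prenex sentences\<close>

text \<open>The variables of a sentence with \<open>r\<close> quantifiers are \<open>0, \<dots>, r - 1\<close>, in the order of the
  prefix; the value of variable \<open>i\<close> is the \<open>i\<close>-th entry of a list.\<close>

datatype atomic = Eq nat nat | Less nat nat

datatype literal = Pos atomic | Neg atomic

definition atoms :: "nat \<Rightarrow> atomic set" where
  "atoms r = {Eq i j | i j. i < r \<and> j < r} \<union> {Less i j | i j. i < r \<and> j < r}"

fun holds_atomic :: "'a bstruct \<Rightarrow> 'a list \<Rightarrow> atomic \<Rightarrow> bool" where
  "holds_atomic S as (Eq i j) \<longleftrightarrow> as ! i = as ! j"
| "holds_atomic S as (Less i j) \<longleftrightarrow> lt S (as ! i) (as ! j)"

fun holds_literal :: "'a bstruct \<Rightarrow> 'a list \<Rightarrow> literal \<Rightarrow> bool" where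
  "holds_literal S as (Pos a) \<longleftrightarrow> holds_atomic S as a"
| "holds_literal S as (Neg a) \<longleftrightarrow> \<not> holds_atomic S as a"

definition holds_conj :: "'a bstruct \<Rightarrow> 'a list \<Rightarrow> literal set \<Rightarrow> bool" where
  "holds_conj S as t \<longleftrightarrow> (\<forall>l\<in>t. holds_literal S as l)"

text \<open>Consistency is satisfiability in some structure. Structures on sets of naturals suffice,
  since any satisfying structure can be cut down to the at most \<open>r\<close> values of the variables.\<close>

definition consistent :: "nat \<Rightarrow> literal set \<Rightarrow> bool" where
  "consistent r t \<longleftrightarrow>
     (\<exists>(S :: nat bstruct) as. length as = r \<and> univ S \<noteq> {} \<and> set as \<subseteq> univ S \<and> holds_conj S as t)"

text \<open>A type is given by the set of its conjuncts, and the matrix of a sentence by the set of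
  its disjuncts.\<close>

definition types :: "nat \<Rightarrow> literal set set" where
  "types r = {t. t \<subseteq> Pos ` atoms r \<union> Neg ` atoms r \<and>
                 (\<forall>a\<in>atoms r. (Pos a \<in> t) \<noteq> (Neg a \<in> t)) \<and>
                 consistent r t}"

datatype quant = Exists | Forall

fun dual :: "quant \<Rightarrow> quant" where
  "dual Exists = Forall"
| "dual Forall = Exists"

record sentence =
  prefix :: "quant list"
  matrix :: "literal set set"

definition is_sentence :: "nat \<Rightarrow> sentence \<Rightarrow> bool" where
  "is_sentence r \<psi> \<longleftrightarrow> length (prefix \<psi>) = r \<and> matrix \<psi> \<subseteq> types r"

fun holds_prenex :: "'a bstruct \<Rightarrow> 'a list \<Rightarrow> quant list \<Rightarrow> literal set set \<Rightarrow> bool" where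
  "holds_prenex S as [] \<theta> \<longleftrightarrow> (\<exists>t\<in>\<theta>. holds_conj S as t)"
| "holds_prenex S as (Exists # Qs) \<theta> \<longleftrightarrow> (\<exists>a\<in>univ S. holds_prenex S (as @ [a]) Qs \<theta>)"
| "holds_prenex S as (Forall # Qs) \<theta> \<longleftrightarrow> (\<forall>a\<in>univ S. holds_prenex S (as @ [a]) Qs \<theta>)"

definition models :: "'a bstruct \<Rightarrow> sentence \<Rightarrow> bool" where
  "models S \<psi> \<longleftrightarrow> holds_prenex S [] (prefix \<psi>) (matrix \<psi>)"

definition separating :: "sentence \<Rightarrow> 'a bstruct set \<Rightarrow> 'b bstruct set \<Rightarrow> bool" where
  "separating \<psi> \<A> \<B> \<longleftrightarrow> (\<forall>S\<in>\<A>. models S \<psi>) \<and> (\<forall>S\<in>\<B>. \<not> models S \<psi>)"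

definition neg_sentence :: "sentence \<Rightarrow> sentence" where
  "neg_sentence \<psi> =
     \<lparr>prefix = map dual (prefix \<psi>), matrix = types (length (prefix \<psi>)) - matrix \<psi>\<rparr>"

definition non_replicating_type :: "sentence \<Rightarrow> literal set \<Rightarrow> bool" where
  "non_replicating_type \<psi> t \<longleftrightarrow>
     (\<forall>i j. i \<noteq> j \<and> Pos (Eq i j) \<in> t \<longrightarrow>
        (prefix \<psi> ! i = Forall \<and> prefix \<psi> ! j = Forall) \<or>
        (prefix \<psi> ! i = Exists \<and> prefix \<psi> ! j = Forall \<and> i < j) \<or>
        (prefix \<psi> ! i = Forall \<and> prefix \<psi> ! j = Exists \<and> j < i))"

definition non_replicating :: "sentence \<Rightarrow> bool" where
  "non_replicating \<psi> \<longleftrightarrow> (\<forall>t\<in>matrix \<psi>. non_replicating_type \<psi> t)"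

end

theory Submission
  imports Defs
begin

text \<open>
  (a) Spoiler first plays \<open>B12\<close>, which is neither the root, nor a leaf, nor directly below the root.
  On the right he then plays, for each possible reply, an element exposing this difference: the
  root against a middle node, a middle node of the other branch against a leaf, a lower node against
  the root. In the last round he plays on the left a node that has no counterpart on the right.

  (b) Let \<open>x\<^sub>i = x\<^sub>j\<close> with \<open>i < j\<close> occur in a type \<open>t\<close>. If both \<open>\<psi>\<close> and \<open>\<not>\<psi>\<close> are non-replicating,
  then \<open>t\<close> is a disjunct of \<open>\<psi>\<close> if \<open>x\<^sub>j\<close> is universal, and of \<open>\<not>\<psi>\<close> if \<open>x\<^sub>j\<close> is existential.
  Applied to the type in which all three variables are equal, this forces the last two quantifiers to
  coincide. Such prefixes do not separate the trees: \<open>RT3\<close> embeds into \<open>RT4\<close> through any given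
  element; conversely, three elements of \<open>RT4\<close> that avoid one of \<open>B11\<close>, \<open>B12\<close>, \<open>B13\<close> can be
  mapped back to \<open>RT3\<close> with \<open>B1\<close>, \<open>B21\<close>, \<open>B22\<close> going to \<open>L1\<close>, \<open>L21\<close>, \<open>L22\<close>, and the remaining
  triple is a chain, which also occurs in \<open>RT3\<close>.
\<close>

section \<open>Matching pairs and types\<close>

lemma matching_pair_holds_atomic:
  assumes "matching_pair (S, as) (T, bs)" and "a \<in> atoms (length as)"
  shows "holds_atomic S as a \<longleftrightarrow> holds_atomic T bs a"
proof -
  obtain f where bs: "bs = map f as" and bij: "bij_betw f (set as) (set bs)"
    and lt: "\<forall>x\<in>set as. \<forall>y\<in>set as. lt S x y \<longleftrightarrow> lt T (f x) (f y)"
    using assms(1) unfolding matching_pair_def by (metis fst_conv snd_conv)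
  have "inj_on f (set as)" using bij by (rule bij_betw_imp_inj_on)
  then show ?thesis
    using assms(2) lt by (auto simp: atoms_def bs inj_on_eq_iff)
qed

lemma matching_pair_map:
  assumes "inj_on f (set as)"
    and "\<And>x y. x \<in> set as \<Longrightarrow> y \<in> set as \<Longrightarrow> lt T (f x) (f y) \<longleftrightarrow> lt S x y"
  shows "matching_pair (S, as) (T, map f as)"
  unfolding matching_pair_def using assms by (auto intro!: exI[of _ f] simp: bij_betw_def)

text \<open>A type consists of literals over atoms that a matching pair preserves, so both tuples
  satisfy the same disjuncts. Quantifiers are handled separately, by choosing matching
  tuples.\<close>

lemma matching_pair_holds_prenex_Nil:
  assumes "matching_pair (S, as) (T, bs)" and "\<theta> \<subseteq> types (length as)"
  shows "holds_prenex S as [] \<theta> \<longleftrightarrow> holds_prenex T bs [] \<theta>"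
proof -
  have "holds_conj S as t \<longleftrightarrow> holds_conj T bs t" if "t \<in> \<theta>" for t
  proof -
    have "t \<subseteq> Pos ` atoms (length as) \<union> Neg ` atoms (length as)"
      using that assms(2) by (auto simp: types_def)
    then have "\<forall>l\<in>t. holds_literal S as l \<longleftrightarrow> holds_literal T bs l"
      using matching_pair_holds_atomic[OF assms(1)] by fastforce
    then show ?thesis by (auto simp: holds_conj_def)
  qed
  then show ?thesis by auto
qed

lemma length_three_eq:
  assumes "length xs = 3" shows "xs = [xs ! 0, xs ! 1, xs ! 2]"
  using assms by (auto simp: numeral_3_eq_3 length_Suc_conv)

section \<open>The order of the trees\<close>

fun ancestors4 :: "node4 \<Rightarrow> node4 set" where
  "ancestors4 B1 = {}"
| "ancestors4 B11 = {B1}"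
| "ancestors4 B12 = {B1, B11}"
| "ancestors4 B13 = {B1, B11, B12}"
| "ancestors4 B21 = {B1}"
| "ancestors4 B22 = {B1, B21}"

fun ancestors3 :: "node3 \<Rightarrow> node3 set" where
  "ancestors3 L1 = {}"
| "ancestors3 L11 = {L1}"
| "ancestors3 L12 = {L1, L11}"
| "ancestors3 L21 = {L1}"
| "ancestors3 L22 = {L1, L21}"

lemma univ_trees [simp]: "univ RT4 = UNIV" "univ RT3 = UNIV"
  by (simp_all add: RT4_def RT3_def)

lemma lt_RT4 [simp]: "lt RT4 x y \<longleftrightarrow> y \<in> ancestors4 x"
proof -
  have "y \<in> ancestors4 x" if "(x, y) \<in> child4\<^sup>+"
    using that by induction (cases x; auto simp: child4_def)+
  moreover have "(x, y) \<in> child4\<^sup>+" if "y \<in> ancestors4 x"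
  proof -
    have e: "(B11, B1) \<in> child4\<^sup>+" "(B12, B11) \<in> child4\<^sup>+" "(B13, B12) \<in> child4\<^sup>+"
      "(B21, B1) \<in> child4\<^sup>+" "(B22, B21) \<in> child4\<^sup>+"
      by (auto simp: child4_def)
    show ?thesis using that e by (cases x) (auto intro: trancl_trans)
  qed
  ultimately show ?thesis by (auto simp: RT4_def)
qed

lemma lt_RT3 [simp]: "lt RT3 x y \<longleftrightarrow> y \<in> ancestors3 x"
proof -
  have "y \<in> ancestors3 x" if "(x, y) \<in> child3\<^sup>+"
    using that by induction (cases x; auto simp: child3_def)+
  moreover have "(x, y) \<in> child3\<^sup>+" if "y \<in> ancestors3 x"
  proof -
    have e: "(L11, L1) \<in> child3\<^sup>+" "(L12, L11) \<in> child3\<^sup>+"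
      "(L21, L1) \<in> child3\<^sup>+" "(L22, L21) \<in> child3\<^sup>+"
      by (auto simp: child3_def)
    show ?thesis using that e by (cases x) (auto intro: trancl_trans)
  qed
  ultimately show ?thesis by (auto simp: RT3_def)
qed

lemma all_node3: "(\<forall>x. P x) \<longleftrightarrow> P L1 \<and> P L11 \<and> P L12 \<and> P L21 \<and> P L22"
  by (metis node3.exhaust)

section \<open>Spoiler's strategy\<close>

text \<open>Spoiler's second move, against the reply to \<open>B12\<close>. After \<open>L1\<close>,
  Duplicator must go below \<open>B12\<close>; after \<open>L11\<close> or \<open>L21\<close>, above
  it; after \<open>L12\<close> or \<open>L22\<close>, to a node incomparable with it.\<close>

fun reply3 :: "node3 \<Rightarrow> node3" where
  "reply3 L1 = L11"
| "reply3 L11 = L1"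
| "reply3 L12 = L21"
| "reply3 L21 = L1"
| "reply3 L22 = L11"

text \<open>The third move: \<open>B11\<close> lies strictly between \<open>B12\<close> and
  \<open>B1\<close>; \<open>B13\<close> lies below \<open>B12\<close>, against a leaf on the right;
  \<open>B1\<close> lies above \<open>B11\<close> or \<open>B13\<close>, against the root or a node
  directly below it.\<close>

fun reply4 :: "node4 \<Rightarrow> node4" where
  "reply4 B1 = B11"
| "reply4 B21 = B13"
| "reply4 B22 = B13"
| "reply4 _ = B1"

lemma reply_no_match:
  "\<not> matching_pair (RT4, [B12, y, reply4 y]) (RT3, [x', reply3 x', z'])"
proof
  assume m: "matching_pair (RT4, [B12, y, reply4 y]) (RT3, [x', reply3 x', z'])"
  have *: "holds_atomic RT4 [B12, y, reply4 y] a \<longleftrightarrow> holds_atomic RT3 [x', reply3 x', z'] a"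
    if "a \<in> atoms 3" for a
    using matching_pair_holds_atomic[OF m] that by (simp add: numeral_3_eq_3)
  \<comment> \<open>Duplicator may play on top, so \<open>y = B12\<close> has to be excluded by the
    equality atom.\<close>
  have "(y = B12 \<longleftrightarrow> reply3 x' = x')"
    "reply3 x' \<in> ancestors3 x' \<longleftrightarrow> y \<in> ancestors4 B12"
    "x' \<in> ancestors3 (reply3 x') \<longleftrightarrow> B12 \<in> ancestors4 y"
    "z' \<in> ancestors3 x' \<longleftrightarrow> reply4 y \<in> ancestors4 B12"
    "x' \<in> ancestors3 z' \<longleftrightarrow> B12 \<in> ancestors4 (reply4 y)"
    "z' \<in> ancestors3 (reply3 x') \<longleftrightarrow> reply4 y \<in> ancestors4 y"
    "reply3 x' \<in> ancestors3 z' \<longleftrightarrow> y \<in> ancestors4 (reply4 y)"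
    using *[of "Eq 0 1"] *[of "Less 0 1"] *[of "Less 1 0"] *[of "Less 0 2"] *[of "Less 2 0"]
      *[of "Less 1 2"] *[of "Less 2 1"]
    by (auto simp: atoms_def)
  then show False
    by (cases y; cases x'; simp; cases z'; simp)
qed

text \<open>Here \<open>g\<close> ranges over all functions, legal or not: the strategy below beats
  every one of them.\<close>

lemma spoiler_wins_by_left_move:
  assumes "spoiler_move on_top A f"
    and "\<And>g. spoiler_wins on_top r (after_spoiler A f) (after_duplicator B g)"
  shows "spoiler_wins on_top (Suc r) A B"
  using assms by auto

lemma spoiler_wins_by_right_move:
  assumes "spoiler_move on_top B f"
    and "\<And>g. spoiler_wins on_top r (after_duplicator A g) (after_spoiler B f)"
  shows "spoiler_wins on_top (Suc r) A B"
  using assms by auto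

lemma spoiler_wins_trees: "spoiler_can_win_without_top 3 {RT4} {RT3}"
proof -
  define A1 where "A1 = after_spoiler (initial {RT4}) (\<lambda>_. B12)"
  have A1: "A1 = {(RT4, [B12])}"
    by (auto simp: A1_def after_spoiler_def initial_def)
  have "spoiler_wins False 2 A1 (after_duplicator (initial {RT3}) g)" for g
  proof -
    define B1' where "B1' = after_duplicator (initial {RT3}) g"
    \<comment> \<open>The last pebble is the one Duplicator has just placed; the same holds for
      \<open>f'\<close> below.\<close>
    define f where "f p = reply3 (last (snd p))" for p :: "node3 pebbled"
    have B1': "\<exists>x. p = (RT3, [x])" if "p \<in> B1'" for p
      using that by (auto simp: B1'_def after_duplicator_def initial_def)
    have ne: "reply3 x \<noteq> x" for x by (cases x) auto
    have move: "spoiler_move False B1' f"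
      using B1' ne by (fastforce simp: spoiler_move_def f_def)
    have "spoiler_wins False 1 (after_duplicator A1 h) (after_spoiler B1' f)" for h
    proof -
      define A2 where "A2 = after_duplicator A1 h"
      define f' where "f' p = reply4 (last (snd p))" for p :: "node4 pebbled"
      have A2: "\<exists>y. p = (RT4, [B12, y])" if "p \<in> A2" for p
        using that by (auto simp: A2_def A1 after_duplicator_def)
      have B2: "\<exists>x. q = (RT3, [x, reply3 x])" if "q \<in> after_spoiler B1' f" for q
        using that B1' by (fastforce simp: after_spoiler_def f_def)
      have ne': "reply4 y \<noteq> y" "reply4 y \<noteq> B12" for y by (cases y; simp)+
      have move': "spoiler_move False A2 f'"
        using A2 ne' by (fastforce simp: spoiler_move_def f'_def)
      have "no_match (after_spoiler A2 f') (after_duplicator (after_spoiler B1' f) k)" for k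
        unfolding no_match_def
      proof (intro ballI)
        fix p q
        assume "p \<in> after_spoiler A2 f'" "q \<in> after_duplicator (after_spoiler B1' f) k"
        then obtain y x z where "p = (RT4, [B12, y, reply4 y])" "q = (RT3, [x, reply3 x, z])"
          using A2 B2 unfolding after_spoiler_def[of A2] after_duplicator_def f'_def by fastforce
        then show "\<not> matching_pair p q" using reply_no_match by simp
      qed
      then show ?thesis
        unfolding A2_def[symmetric] One_nat_def
        by (intro spoiler_wins_by_left_move[OF move']) simp
    qed
    then show ?thesis
      unfolding B1'_def[symmetric] numeral_2_eq_2 One_nat_def
      by (rule spoiler_wins_by_right_move[OF move])
  qed
  moreover have "spoiler_move False (initial {RT4}) (\<lambda>_. B12)"
    by (auto simp: spoiler_move_def initial_def)
  ultimately show ?thesis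
    unfolding spoiler_can_win_without_top_def A1_def
    using spoiler_wins_by_left_move[of False "initial {RT4}" "\<lambda>_. B12" 2 "initial {RT3}"]
    by (simp add: numeral_3_eq_3 numeral_2_eq_2 del: spoiler_wins.simps)
qed

section \<open>Transfer between the trees\<close>

text \<open>The long branch of \<open>RT4\<close> has one node too many. Skipping \<open>B12\<close>
  or skipping \<open>B11\<close> gives two embeddings whose ranges cover \<open>RT4\<close>.\<close>

lemma embedding_through:
  "\<exists>e. inj e \<and> x \<in> range e \<and> (\<forall>y z. lt RT4 (e y) (e z) \<longleftrightarrow> lt RT3 y z)"
proof -
  define e where
    "e u v w = (case w of L1 \<Rightarrow> B1 | L11 \<Rightarrow> u | L12 \<Rightarrow> v | L21 \<Rightarrow> B21 | L22 \<Rightarrow> B22)" for u v w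
  have "inj (e B11 B13)" "inj (e B12 B13)"
    "\<forall>y z. lt RT4 (e B11 B13 y) (e B11 B13 z) \<longleftrightarrow> lt RT3 y z"
    "\<forall>y z. lt RT4 (e B12 B13 y) (e B12 B13 z) \<longleftrightarrow> lt RT3 y z"
    by (simp_all add: inj_def e_def all_node3)
  moreover have "x \<in> range (e B11 B13) \<or> x \<in> range (e B12 B13)"
    by (cases x) (auto simp: e_def image_iff intro: exI[of _ L1] exI[of _ L11] exI[of _ L12]
        exI[of _ L21] exI[of _ L22] split: node3.splits)
  ultimately show ?thesis by blast
qed

text \<open>The flag tells whether \<open>B11\<close> is pebbled: if so, \<open>B12\<close> has to
  go below its image \<open>L11\<close>; otherwise \<open>B12\<close> takes the place
  \<open>L11\<close>.\<close>

definition collapse :: "bool \<Rightarrow> node4 \<Rightarrow> node3" where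
  "collapse b u = (case u of B1 \<Rightarrow> L1 | B11 \<Rightarrow> L11 | B12 \<Rightarrow> if b then L12 else L11 | B13 \<Rightarrow> L12
     | B21 \<Rightarrow> L21 | B22 \<Rightarrow> L22)"

fun mirror :: "node3 \<Rightarrow> node3" where
  "mirror L1 = L1"
| "mirror L11 = L21"
| "mirror L12 = L22"
| "mirror L21 = L11"
| "mirror L22 = L12"

lemma mirror_simps [simp]:
  "mirror (mirror x) = x" "inj mirror" "mirror y \<in> ancestors3 (mirror x) \<longleftrightarrow> y \<in> ancestors3 x"
proof -
  show *: "mirror (mirror x) = x" for x by (cases x) auto
  show "inj mirror" by (rule inj_on_inverseI[of _ mirror]) (rule *)
  show "mirror y \<in> ancestors3 (mirror x) \<longleftrightarrow> y \<in> ancestors3 x"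
    by (cases x; cases y) auto
qed

lemma collapse_matching_pair:
  assumes "\<not> {B11, B12, B13} \<subseteq> set as"
  shows "matching_pair (RT4, as) (RT3, map (collapse (B11 \<in> set as)) as)"
proof (rule matching_pair_map)
  have eq: "x = y" if "x \<in> set as" "y \<in> set as"
    "collapse (B11 \<in> set as) x = collapse (B11 \<in> set as) y" for x y
    using assms that by (cases x; cases y; auto simp: collapse_def split: if_splits)
  then show "inj_on (collapse (B11 \<in> set as)) (set as)" by (rule inj_onI)
  show "lt RT3 (collapse (B11 \<in> set as) x) (collapse (B11 \<in> set as) y) \<longleftrightarrow> lt RT4 x y"
    if "x \<in> set as" "y \<in> set as" for x y
    using assms that by (cases x; cases y; auto simp: collapse_def split: if_splits)
qed

text \<open>Serves the prefix \<open>Forall\<close>, \<open>Exists\<close>, \<open>Exists\<close>.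
  Choosing \<open>x\<close> off the long branch keeps the bad chain out of the tuple;
  \<open>mirror\<close> then reaches \<open>L11\<close> and \<open>L12\<close>.\<close>

lemma realised_through:
  "\<exists>x. \<forall>y z. \<exists>y' z'. matching_pair (RT4, [x, y, z]) (RT3, [x', y', z'])"
proof -
  define x where
    "x = (case x' of L1 \<Rightarrow> B1 | L11 \<Rightarrow> B21 | L12 \<Rightarrow> B22 | L21 \<Rightarrow> B21 | L22 \<Rightarrow> B22)"
  define m where "m = (if x' \<in> {L11, L12} then mirror else id)"
  have m: "m = id \<or> m = mirror" by (simp add: m_def)
  have x: "x \<in> {B1, B21, B22}" by (cases x') (simp_all add: x_def)
  \<comment> \<open>On \<open>B1\<close>, \<open>B21\<close>, \<open>B22\<close> the flag has no
    effect, so \<open>y\<close> and \<open>z\<close> cannot disturb the image of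
    \<open>x\<close>.\<close>
  have x': "x' = m (collapse b x)" for b
    by (cases x') (simp_all add: x_def m_def collapse_def)
  have "\<exists>y' z'. matching_pair (RT4, [x, y, z]) (RT3, [x', y', z'])" for y z
  proof -
    let ?as = "[x, y, z]"
    let ?h = "collapse (B11 \<in> set ?as)"
    have "\<not> {B11, B12, B13} \<subseteq> set ?as" using x by auto
    from collapse_matching_pair[OF this]
    obtain f where f: "map f ?as = map ?h ?as"
      "bij_betw f (set ?as) (set (map ?h ?as))"
      "\<forall>u\<in>set ?as. \<forall>v\<in>set ?as. lt RT4 u v \<longleftrightarrow> lt RT3 (f u) (f v)"
      unfolding matching_pair_def fst_conv snd_conv by blast
    have "matching_pair (RT4, ?as) (RT3, map (m \<circ> f) ?as)"
    proof (rule matching_pair_map)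
      have "inj m" using m by auto
      then show "inj_on (m \<circ> f) (set ?as)"
        using comp_inj_on[OF bij_betw_imp_inj_on[OF f(2)]] inj_on_subset[of m UNIV] by blast
      have "\<And>u v. lt RT3 (m u) (m v) \<longleftrightarrow> lt RT3 u v" using m by auto
      then show "lt RT3 ((m \<circ> f) u) ((m \<circ> f) v) \<longleftrightarrow> lt RT4 u v"
        if "u \<in> set ?as" "v \<in> set ?as" for u v
        using f(3) that by (metis comp_apply)
    qed
    moreover have "(m \<circ> f) x = x'" using f(1) x'[of "B11 \<in> set ?as"] by simp
    ultimately show ?thesis by auto
  qed
  then show ?thesis by blast
qed

lemma realised: "\<exists>x' y' z'. matching_pair (RT4, [x, y, z]) (RT3, [x', y', z'])"
proof (cases "{B11, B12, B13} \<subseteq> {x, y, z}")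
  case False
  then show ?thesis using collapse_matching_pair[of "[x, y, z]"] by auto
next
  case True
  define h where "h u = (case u of B11 \<Rightarrow> L1 | B12 \<Rightarrow> L11 | _ \<Rightarrow> L12)" for u
  have xyz: "{x, y, z} = {B11, B12, B13}"
    using True by auto
  have "matching_pair (RT4, [x, y, z]) (RT3, map h [x, y, z])"
    by (rule matching_pair_map) (auto simp: xyz h_def)
  then show ?thesis by auto
qed

text \<open>Serves the prefix \<open>Exists\<close>, \<open>Forall\<close>, \<open>Forall\<close>:
  the witness is pulled back along an embedding through it.\<close>

lemma embed_tuple:
  "\<exists>x'. \<forall>y' z'. \<exists>y z. matching_pair (RT3, [x', y', z']) (RT4, [x, y, z])"
proof -
  obtain e x' where e: "inj e" "x = e x'" "\<forall>y z. lt RT4 (e y) (e z) \<longleftrightarrow> lt RT3 y z"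
    using embedding_through[of x] by auto
  have "matching_pair (RT3, [x', y', z']) (RT4, [x, e y', e z'])" for y' z'
    using matching_pair_map[of e "[x', y', z']" RT4 RT3] e by (simp add: inj_on_def)
  then show ?thesis by blast
qed

lemma embed_any_tuple: "\<exists>x y z. matching_pair (RT3, [x', y', z']) (RT4, [x, y, z])"
proof -
  obtain e where e: "inj e" "\<forall>y z. lt RT4 (e y) (e z) \<longleftrightarrow> lt RT3 y z"
    using embedding_through by blast
  have "matching_pair (RT3, [x', y', z']) (RT4, map e [x', y', z'])"
    using e by (intro matching_pair_map) (auto simp: inj_on_def)
  then show ?thesis by auto
qed

lemma not_separating_if_last_quantifiers_equal:
  assumes "is_sentence 3 \<psi>" and "prefix \<psi> ! 1 = prefix \<psi> ! 2"
  shows "\<not> separating \<psi> {RT4} {RT3}"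
proof -
  let ?\<theta> = "matrix \<psi>"
  have \<theta>: "?\<theta> \<subseteq> types 3" and len: "length (prefix \<psi>) = 3"
    using assms(1) by (auto simp: is_sentence_def)
  obtain Q R where pre: "prefix \<psi> = [Q, R, R]"
    using length_three_eq[OF len] assms(2) by metis
  have 43: "holds_prenex RT3 [x', y', z'] [] ?\<theta>"
    if "matching_pair (RT4, [x, y, z]) (RT3, [x', y', z'])" "holds_prenex RT4 [x, y, z] [] ?\<theta>"
    for x y z x' y' z'
    using matching_pair_holds_prenex_Nil[OF that(1), of ?\<theta>] that(2) \<theta>
    by (simp add: numeral_3_eq_3)
  have 34: "holds_prenex RT3 [x', y', z'] [] ?\<theta>"
    if "matching_pair (RT3, [x', y', z']) (RT4, [x, y, z])" "holds_prenex RT4 [x, y, z] [] ?\<theta>"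
    for x y z x' y' z'
    using matching_pair_holds_prenex_Nil[OF that(1), of ?\<theta>] that(2) \<theta>
    by (simp add: numeral_3_eq_3)
  \<comment> \<open>Each of the four prefixes uses one transfer lemma. The matrix stays folded in
    the simplifications so that \<open>43\<close> and \<open>34\<close> apply to it.\<close>
  have "models RT3 \<psi>" if "models RT4 \<psi>"
  proof (cases R)
    case Exists
    show ?thesis
    proof (cases Q)
      case E: Exists
      obtain x y z where "holds_prenex RT4 [x, y, z] [] ?\<theta>"
        using \<open>models RT4 \<psi>\<close> unfolding models_def pre E Exists
        by (simp del: holds_prenex.simps(1)) blast
      then obtain x' y' z' where "holds_prenex RT3 [x', y', z'] [] ?\<theta>"
        using realised 43 by meson
      then show ?thesis unfolding models_def pre E Exists
        by (simp del: holds_prenex.simps(1)) blast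
    next
      case F: Forall
      have "\<forall>x. \<exists>y z. holds_prenex RT4 [x, y, z] [] ?\<theta>"
        using \<open>models RT4 \<psi>\<close> unfolding models_def pre F Exists
        by (simp del: holds_prenex.simps(1))
      then have "\<forall>x'. \<exists>y' z'. holds_prenex RT3 [x', y', z'] [] ?\<theta>"
        using realised_through 43 by meson
      then show ?thesis unfolding models_def pre F Exists
        by (simp del: holds_prenex.simps(1))
    qed
  next
    case Forall
    show ?thesis
    proof (cases Q)
      case E: Exists
      have "\<exists>x. \<forall>y z. holds_prenex RT4 [x, y, z] [] ?\<theta>"
        using \<open>models RT4 \<psi>\<close> unfolding models_def pre E Forall
        by (simp del: holds_prenex.simps(1))
      then have "\<exists>x'. \<forall>y' z'. holds_prenex RT3 [x', y', z'] [] ?\<theta>"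
        using embed_tuple 34 by meson
      then show ?thesis unfolding models_def pre E Forall
        by (simp del: holds_prenex.simps(1))
    next
      case F: Forall
      have "\<forall>x y z. holds_prenex RT4 [x, y, z] [] ?\<theta>"
        using \<open>models RT4 \<psi>\<close> unfolding models_def pre F Forall
        by (simp del: holds_prenex.simps(1))
      then have "\<forall>x' y' z'. holds_prenex RT3 [x', y', z'] [] ?\<theta>"
        using embed_any_tuple 34 by meson
      then show ?thesis unfolding models_def pre F Forall
        by (simp del: holds_prenex.simps(1))
    qed
  qed
  then show ?thesis by (auto simp: separating_def)
qed

section \<open>Non-replicating sentences\<close>

definition equal_type :: "nat \<Rightarrow> literal set" where
  "equal_type r = {Pos (Eq i j) | i j. i < r \<and> j < r} \<union> {Neg (Less i j) | i j. i < r \<and> j < r}"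

lemma equal_type_in_types: "equal_type r \<in> types r"
proof -
  have "holds_conj \<lparr>univ = UNIV, lt = (\<lambda>_ _. False)\<rparr> (replicate r (0::nat)) (equal_type r)"
    by (auto simp: holds_conj_def equal_type_def)
  then have "consistent r (equal_type r)"
    unfolding consistent_def
    by (intro exI[of _ "\<lparr>univ = UNIV, lt = (\<lambda>_ _. False)\<rparr>"] exI[of _ "replicate r 0"]) auto
  then show ?thesis
    by (auto simp: types_def atoms_def equal_type_def)
qed

text \<open>In \<open>Eq 0 j\<close> every permitted pattern makes the later variable universal; the
  remaining one would require \<open>j < 0\<close>.\<close>

lemma non_replicating_equal_type:
  assumes "non_replicating \<psi>" and "equal_type r \<in> matrix \<psi>" and "0 < j" and "j < r"
  shows "prefix \<psi> ! j = Forall"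
proof -
  have "Pos (Eq 0 j) \<in> equal_type r" using assms(3,4) by (auto simp: equal_type_def)
  then show ?thesis
    using assms unfolding non_replicating_def non_replicating_type_def
    by (metis less_nat_zero_code)
qed

lemma dual_eq_Forall [simp]: "dual Q = Forall \<longleftrightarrow> Q = Exists"
  by (cases Q) auto

text \<open>\<open>equal_type r\<close> is a disjunct of \<open>\<psi>\<close> or of its negation,
  and in that sentence every quantifier after the first is universal.\<close>

lemma non_replicating_quantifiers_equal:
  assumes "is_sentence r \<psi>" and "non_replicating \<psi>" and "non_replicating (neg_sentence \<psi>)"
    and "0 < i" "i < r" "0 < j" "j < r"
  shows "prefix \<psi> ! i = prefix \<psi> ! j"
proof (cases "equal_type r \<in> matrix \<psi>")
  case True
  then show ?thesis using non_replicating_equal_type assms by metis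
next
  case False
  have len: "length (prefix \<psi>) = r" using assms(1) by (simp add: is_sentence_def)
  have "equal_type r \<in> matrix (neg_sentence \<psi>)"
    using False equal_type_in_types len by (simp add: neg_sentence_def)
  then have "prefix (neg_sentence \<psi>) ! i = Forall" "prefix (neg_sentence \<psi>) ! j = Forall"
    using non_replicating_equal_type assms by blast+
  then show ?thesis using assms len by (simp add: neg_sentence_def)
qed

theorem theorem4p10:
  shows "spoiler_can_win_without_top 3 {RT4} {RT3} \<and>
    \<not> (\<exists>\<psi>. is_sentence 3 \<psi> \<and> separating \<psi> {RT4} {RT3} \<and>
            non_replicating \<psi> \<and> non_replicating (neg_sentence \<psi>))"
proof
  show "spoiler_can_win_without_top 3 {RT4} {RT3}" by (rule spoiler_wins_trees)
  show "\<not> (\<exists>\<psi>. is_sentence 3 \<psi> \<and> separating \<psi> {RT4} {RT3} \<and>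
            non_replicating \<psi> \<and> non_replicating (neg_sentence \<psi>))"
  proof clarify
    fix \<psi>
    assume \<psi>: "is_sentence 3 \<psi>" "non_replicating \<psi>" "non_replicating (neg_sentence \<psi>)"
      and sep: "separating \<psi> {RT4} {RT3}"
    have "prefix \<psi> ! 1 = prefix \<psi> ! 2"
      by (rule non_replicating_quantifiers_equal[OF \<psi>]) auto
    then show False using not_separating_if_last_quantifiers_equal \<psi>(1) sep by blast
  qed
qed

end
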